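(* Let $k\geq 2$ and let $p=(p_1,\ldots,p_k)$ and $q=(q_1,\ldots,q_k)$ be arrays of positive integers such that $p \succ q$ and $p_1+\cdots+p_k = q_1+\cdots+q_k = n-1$. Then $$ecc(S(p_1,p_2,\ldots,p_k)) \geq ecc(S(q_1,q_2,\ldots,q_k)).$$
   Context: For a connected graph $H$ on vertex set $V$ with $|V|=n$, $\varepsilon(v)=\max_{u\in V} d(u,v)$ and $ecc(H)=\frac{1}{n}\sum_{v\in V}\varepsilon(v)$. For integers $n_1\geq n_2\geq\cdots\geq n_k\geq 1$, $S(n_1,\ldots,n_k)$ denotes the tree on $n=n_1+\cdots+n_k+1$ vertices having a vertex $v$ such that $S(n_1,\ldots,n_k)-v$ is the disjoint union of paths $P_{n_1},\ldots,P_{n_k}$, where $v$ is adjacent to exactly one end vertex of each of these paths. For integer arrays $x=(x_1,\ldots,x_k)$, $y=(y_1,\ldots,y_k)$, $x \succ y$ ($x$ majorizes $y$) means: $x_1\geq\cdots\geq x_k$ and $y_1\geq\cdots\geq y_k$; $x_1+\cdots+x_j\geq y_1+\cdots+y_j$ for every $1\leq j<k$; and $x_1+\cdots+x_k=y_1+\cdots+y_k$. *)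

theory Defs
  imports "Graph_Theory.Graph_Theory"
begin

text \<open>
  Undirected graphs are symmetric digraphs. Distance and eccentricity are natural numbers, so they
  are meaningful for finite connected graphs only.
\<close>

definition graph_dist :: "('a, 'b) pre_digraph \<Rightarrow> 'a \<Rightarrow> 'a \<Rightarrow> nat" where
  "graph_dist G u v = (INF w \<in> {w. pre_digraph.awalk G u w v}. length w)"

definition eccentricity :: "('a, 'b) pre_digraph \<Rightarrow> 'a \<Rightarrow> nat" where
  "eccentricity G v = Max ((\<lambda>u. graph_dist G u v) ` verts G)"

definition ecc :: "('a, 'b) pre_digraph \<Rightarrow> real" where
  "ecc G = (1 / real (card (verts G))) * (\<Sum>v \<in> verts G. real (eccentricity G v))"

text \<open>
  A concrete representative of the isomorphism class of \<open>S(n\<^sub>1, \<dots>, n\<^sub>k)\<close>, for a list of positive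
  entries. \<open>None\<close> is the centre; \<open>Some (i, j)\<close> is the \<open>j\<close>-th vertex of the \<open>i\<close>-th path, both counted
  from 0, and \<open>Some (i, 0)\<close> is the end vertex of that path attached to the centre.
\<close>

definition S_verts :: "nat list \<Rightarrow> (nat \<times> nat) option set" where
  "S_verts ns = insert None {Some (i, j) | i j. i < length ns \<and> j < ns ! i}"

definition S_out :: "nat list \<Rightarrow> (nat \<times> nat) option rel" where
  "S_out ns = {(None, Some (i, 0)) | i. i < length ns}
     \<union> {(Some (i, j), Some (i, Suc j)) | i j. i < length ns \<and> Suc j < ns ! i}"

definition S :: "nat list \<Rightarrow> (nat \<times> nat) option pair_pre_digraph" where
  "S ns = \<lparr> pverts = S_verts ns, parcs = S_out ns \<union> (S_out ns)\<inverse> \<rparr>"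

definition majorizes :: "'a::linordered_semidom list \<Rightarrow> 'a list \<Rightarrow> bool" (infix \<open>\<succ>\<close> 50) where
  "x \<succ> y \<longleftrightarrow> length x = length y \<and> sorted_wrt (\<ge>) x \<and> sorted_wrt (\<ge>) y
     \<and> (\<forall>j. 1 \<le> j \<and> j < length x \<longrightarrow> sum_list (take j x) \<ge> sum_list (take j y))
     \<and> sum_list x = sum_list y"

lemma S_verts_alt:
  "S_verts ns = insert None (Some ` (SIGMA i:{..<length ns}. {..<ns ! i}))"
  by (auto simp: S_verts_def)

lemma finite_S_verts: "finite (S_verts ns)"
  by (simp add: S_verts_alt)

lemma card_S_verts: "card (pverts (S ns)) = sum_list ns + 1"
proof -
  have "card (SIGMA i:{..<length ns}. {..<ns ! i}) = sum_list ns"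
    by (simp add: sum_list_sum_nth atLeast0LessThan)
  then show ?thesis
    by (simp add: S_def S_verts_alt card_image card_insert_if image_iff)
qed

lemma pair_graph_S:
  assumes "\<forall>m \<in> set ns. 0 < m"
  shows "pair_graph (S ns)"
proof -
  have pos: "0 < ns ! i" if "i < length ns" for i
    using assms that nth_mem by blast
  have sub: "parcs (S ns) \<subseteq> S_verts ns \<times> S_verts ns"
    using pos by (auto simp: S_def S_out_def S_verts_def)
  have fin: "finite (parcs (S ns))"
    using sub finite_S_verts by (meson finite_SigmaI finite_subset)
  show ?thesis
  proof
    show "\<And>e. e \<in> parcs (S ns) \<Longrightarrow> fst e \<in> pverts (S ns)"
      "\<And>e. e \<in> parcs (S ns) \<Longrightarrow> snd e \<in> pverts (S ns)"
      using sub by (auto simp: S_def)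
    show "finite (pverts (S ns))" by (simp add: S_def finite_S_verts)
    show "finite (parcs (S ns))" by (rule fin)
    show "\<And>e. e \<in> parcs (S ns) \<Longrightarrow> fst e \<noteq> snd e"
      by (auto simp: S_def S_out_def)
    show "symmetric (with_proj (S ns))"
      by (auto simp: symmetric_def S_def intro: symI)
  qed
qed

lemma connected_S:
  assumes "\<forall>m \<in> set ns. 0 < m"
  shows "connected (with_proj (S ns))"
proof -
  interpret pair_graph "S ns" using assms by (rule pair_graph_S)
  have root: "None \<rightarrow>\<^sup>*\<^bsub>with_proj (S ns)\<^esub> Some (i, j)" if "i < length ns" "j < ns ! i" for i j
    using that(2)
  proof (induction j)
    case 0
    have "(None, Some (i, 0)) \<in> parcs (S ns)" using that(1) by (auto simp: S_def S_out_def)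
    then show ?case by (simp add: reachable_adjI)
  next
    case (Suc j)
    have "(Some (i, j), Some (i, Suc j)) \<in> parcs (S ns)"
      using that(1) Suc.prems by (auto simp: S_def S_out_def)
    then show ?case using Suc by (simp add: reachable_adj_trans)
  qed
  have r: "None \<rightarrow>\<^sup>*\<^bsub>with_proj (S ns)\<^esub> v" if "v \<in> pverts (S ns)" for v
  proof (cases v)
    case None
    then show ?thesis using that by simp
  next
    case (Some ij)
    then show ?thesis using that root[of "fst ij" "snd ij"]
      by (auto simp: S_def S_verts_def)
  qed
  have "strongly_connected (with_proj (S ns))"
  proof (rule strongly_connectedI)
    show "verts (with_proj (S ns)) \<noteq> {}" by (simp add: S_def S_verts_def)
    fix u v assume "u \<in> verts (with_proj (S ns))" "v \<in> verts (with_proj (S ns))"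
    then show "u \<rightarrow>\<^sup>*\<^bsub>with_proj (S ns)\<^esub> v"
      using r symmetric_reachable[OF sym_arcs] by (metis reachable_trans with_proj_simps(1))
  qed
  then show ?thesis
    by (simp add: connected_def strongly_connected_def reachable_mk_symmetric_eq[OF sym_arcs])
qed

end

theory Submission
  imports Defs
begin

text \<open>
  Let \<open>D = p\<^sub>1 + p\<^sub>2\<close>. The first two legs form a diametral path, and a vertex at depth \<open>d\<close> on any
  other leg has eccentricity \<open>p\<^sub>1 + d\<close>. Hence the total eccentricity is
  \<open>(\<Sum>t\<le>D. max t (D - t)) + p\<^sub>1 (p\<^sub>3 + \<dots> + p\<^sub>k) + (\<Sum>i\<ge>3. T p\<^sub>i)\<close> with \<open>T m = m (m + 1) / 2\<close>.
  If \<open>p\<close> majorizes \<open>q\<close>, put \<open>\<delta> = (p\<^sub>1 + p\<^sub>2) - (q\<^sub>1 + q\<^sub>2) \<ge> 0\<close>. The path part grows by at least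
  \<open>(q\<^sub>1 + q\<^sub>2) \<delta>\<close>. The remaining legs lose at most \<open>q\<^sub>1 \<delta>\<close> in the linear term and, by convexity of \<open>T\<close>
  and Abel summation, at most \<open>q\<^sub>3 \<delta> \<le> q\<^sub>2 \<delta>\<close> in the quadratic one.
\<close>

section \<open>Distances in starlike trees\<close>

text \<open>Candidate closed form for the distance, with \<open>j\<close> at depth
  \<open>Suc j\<close>. As subtraction truncates, \<open>(j - j') + (j' - j)\<close> is the absolute
  difference. Distinct legs communicate only through the centre.\<close>

fun S_dist :: "(nat \<times> nat) option \<Rightarrow> (nat \<times> nat) option \<Rightarrow> nat" where
  "S_dist None None = 0"
| "S_dist None (Some (i, j)) = Suc j"
| "S_dist (Some (i, j)) None = Suc j"
| "S_dist (Some (i, j)) (Some (i', j')) =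
     (if i = i' then (j - j') + (j' - j) else Suc j + Suc j')"

text \<open>The vertex at depth \<open>d\<close> of leg \<open>i\<close>, where depth 0 is the centre for every leg.\<close>

fun leg_vertex :: "nat \<Rightarrow> nat \<Rightarrow> (nat \<times> nat) option" where
  "leg_vertex i 0 = None"
| "leg_vertex i (Suc j) = Some (i, j)"

lemma leg_vertex_arcs:
  assumes "i < length ns" "d < ns ! i"
  shows "(leg_vertex i d, leg_vertex i (Suc d)) \<in> parcs (S ns)"
    and "(leg_vertex i (Suc d), leg_vertex i d) \<in> parcs (S ns)"
  using assms by (cases d; auto simp: S_def S_out_def)+

lemma leg_vertex_in_verts:
  assumes "i < length ns" "d \<le> ns ! i"
  shows "leg_vertex i d \<in> pverts (S ns)"
  using assms by (cases d) (auto simp: S_def S_verts_def)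

lemma S_vertex_cases:
  assumes "v \<in> pverts (S ns)" "ns \<noteq> []"
  obtains i d where "i < length ns" "d \<le> ns ! i" "v = leg_vertex i d"
proof (cases v)
  case None
  then show ?thesis using that[of 0 0] assms(2) by simp
next
  case (Some ij)
  then show ?thesis using that[of "fst ij" "Suc (snd ij)"] assms(1)
    by (auto simp: S_def S_verts_def)
qed

context
  fixes ns :: "nat list"
  assumes pos: "\<forall>m \<in> set ns. 0 < m"
begin

interpretation G: pair_graph "S ns"
  using pos by (rule pair_graph_S)

lemma leg_walk_up:
  assumes "i < length ns" "d + m \<le> ns ! i"
  shows "\<exists>w. G.awalk (leg_vertex i d) w (leg_vertex i (d + m)) \<and> length w = m"
  using assms
proof (induction m arbitrary: d)
  case 0
  then show ?case
    using leg_vertex_in_verts[of i ns d] by (auto simp: G.awalk_Nil_iff)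
next
  case (Suc m)
  obtain w where "G.awalk (leg_vertex i (Suc d)) w (leg_vertex i (Suc d + m))" "length w = m"
    using Suc.IH[of "Suc d"] Suc.prems by auto
  then show ?case
    using leg_vertex_arcs(1)[of i ns d] leg_vertex_in_verts[of i ns d] Suc.prems
    by (intro exI[of _ "(leg_vertex i d, leg_vertex i (Suc d)) # w"])
      (auto simp: G.awalk_Cons_iff)
qed

lemma leg_walk_down:
  assumes "i < length ns" "d + m \<le> ns ! i"
  shows "\<exists>w. G.awalk (leg_vertex i (d + m)) w (leg_vertex i d) \<and> length w = m"
  using assms
proof (induction m)
  case 0
  then show ?case
    using leg_vertex_in_verts[of i ns d] by (auto simp: G.awalk_Nil_iff)
next
  case (Suc m)
  obtain w where "G.awalk (leg_vertex i (d + m)) w (leg_vertex i d)" "length w = m"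
    using Suc by auto
  then show ?case
    using leg_vertex_arcs(2)[of i ns "d + m"] leg_vertex_in_verts[of i ns "Suc (d + m)"] Suc.prems
    by (intro exI[of _ "(leg_vertex i (Suc (d + m)), leg_vertex i (d + m)) # w"])
      (auto simp: G.awalk_Cons_iff)
qed

lemma S_dist_leg_vertex:
  "S_dist (leg_vertex i d) (leg_vertex i' d') =
     (if i = i' then (d - d') + (d' - d) else d + d')"
  by (cases d; cases d') auto

lemma S_dist_walk:
  assumes "u \<in> pverts (S ns)" "v \<in> pverts (S ns)"
  shows "\<exists>w. G.awalk u w v \<and> length w = S_dist u v"
proof (cases "ns = []")
  case True
  then have "u = None" "v = None" using assms by (auto simp: S_def S_verts_def)
  then show ?thesis using assms by (auto intro!: exI[of _ "[]"] simp: G.awalk_Nil_iff)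
next
  case False
  obtain i d where u: "i < length ns" "d \<le> ns ! i" "u = leg_vertex i d"
    using S_vertex_cases[OF assms(1) False] .
  obtain i' d' where v: "i' < length ns" "d' \<le> ns ! i'" "v = leg_vertex i' d'"
    using S_vertex_cases[OF assms(2) False] .
  show ?thesis
  proof (cases "i = i'")
    case True
    show ?thesis
    proof (cases "d \<le> d'")
      case le: True
      then show ?thesis
        using leg_walk_up[of i d "d' - d"] u v True by (simp add: S_dist_leg_vertex)
    next
      case False
      then show ?thesis
        using leg_walk_down[of i d' "d - d'"] u v True by (simp add: S_dist_leg_vertex)
    qed
  next
    case False
    \<comment> \<open>Depth 0 is the centre on both legs, so a walk down one leg can be joined to a
      walk up the other.\<close>
    obtain w1 where w1: "G.awalk u w1 None" "length w1 = d"
      using leg_walk_down[of i 0 d] u by auto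
    obtain w2 where w2: "G.awalk None w2 v" "length w2 = d'"
      using leg_walk_up[of i' 0 d'] v by auto
    have "G.awalk u (w1 @ w2) v" using w1 w2 by (auto intro: G.awalk_appendI)
    then show ?thesis
      using w1 w2 u v False by (intro exI[of _ "w1 @ w2"]) (simp add: S_dist_leg_vertex)
  qed
qed

lemma S_dist_arc:
  assumes "(x, y) \<in> parcs (S ns)"
  shows "S_dist x v \<le> Suc (S_dist y v)"
  using assms by (cases v) (auto simp: S_def S_out_def)

text \<open>Each arc lowers the closed form towards \<open>v\<close> by at most one. Together with
  \<open>S_dist_walk\<close> this makes the infimum in \<open>graph_dist\<close> an attained
  minimum.\<close>

lemma S_dist_le_length:
  assumes "G.awalk u w v"
  shows "S_dist u v \<le> length w"
  using assms
proof (induction w arbitrary: u)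
  case Nil
  then show ?case by (cases v) (auto simp: G.awalk_Nil_iff)
next
  case (Cons e w)
  then have "e \<in> parcs (S ns)" "fst e = u" "G.awalk (snd e) w v"
    by (auto simp: G.awalk_Cons_iff)
  then show ?case
    using Cons.IH[of "snd e"] S_dist_arc[of u "snd e" v] by (cases e) auto
qed

lemma graph_dist_S:
  assumes "u \<in> pverts (S ns)" "v \<in> pverts (S ns)"
  shows "graph_dist (S ns) u v = S_dist u v"
proof -
  obtain w where "G.awalk u w v" "length w = S_dist u v"
    using S_dist_walk[OF assms] by blast
  then have "S_dist u v \<in> length ` {w. G.awalk u w v}" by force
  then show ?thesis
    unfolding graph_dist_def
    by (intro cInf_eq_minimum) (auto intro: S_dist_le_length)
qed

lemma eccentricity_S:
  assumes "v \<in> pverts (S ns)"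
  shows "eccentricity (S ns) v = Max ((\<lambda>u. S_dist u v) ` pverts (S ns))"
  using assms by (simp add: eccentricity_def graph_dist_S cong: image_cong)

lemma eccentricity_S_eqI:
  assumes "v \<in> pverts (S ns)" "u \<in> pverts (S ns)" "S_dist u v = m"
    and "S_dist None v \<le> m"
    and "\<And>i j. i < length ns \<Longrightarrow> j < ns ! i \<Longrightarrow> S_dist (Some (i, j)) v \<le> m"
  shows "eccentricity (S ns) v = m"
  unfolding eccentricity_S[OF assms(1)]
proof (rule Max_eqI)
  show "m \<in> (\<lambda>u. S_dist u v) ` pverts (S ns)" using assms by blast
  show "y \<le> m" if "y \<in> (\<lambda>u. S_dist u v) ` pverts (S ns)" for y
    using that assms(4,5) by (auto simp: S_def S_verts_def)
qed simp

end

section \<open>Total eccentricity\<close>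

lemma sum_lessThan_add:
  fixes f :: "nat \<Rightarrow> 'a::comm_monoid_add"
  shows "(\<Sum>t<m + n. f t) = (\<Sum>t<m. f t) + (\<Sum>j<n. f (m + j))"
  by (induction n) (simp_all add: add.assoc)

lemma nth_le_hd_of_sorted:
  assumes "sorted_wrt (\<ge>) (a # b # r)" "i < length (a # b # r)"
  shows "(a # b # r) ! i \<le> (a::nat)" "i \<noteq> 0 \<Longrightarrow> (a # b # r) ! i \<le> b"
proof -
  have "\<forall>x \<in> set r. x \<le> b" "b \<le> a" using assms by auto
  moreover from this have "\<forall>x \<in> set r. x \<le> a" by auto
  ultimately show "(a # b # r) ! i \<le> a" "i \<noteq> 0 \<Longrightarrow> (a # b # r) ! i \<le> b"
    using assms by (auto simp: nth_Cons split: nat.splits)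
qed

context
  fixes a b :: nat and r ns :: "nat list"
  assumes ns: "ns = a # b # r"
    and pos: "\<forall>m \<in> set ns. 0 < m"
    and sorted: "sorted_wrt (\<ge>) ns"
begin

lemma leg_le:
  assumes "i < length ns"
  shows "ns ! i \<le> a" "i \<noteq> 0 \<Longrightarrow> ns ! i \<le> b"
  using nth_le_hd_of_sorted[of a b r i] sorted assms by (auto simp: ns)

lemma leg_ends:
  "0 < a" "0 < b" "b \<le> a" "Some (0, a - 1) \<in> pverts (S ns)" "Some (1, b - 1) \<in> pverts (S ns)"
  using pos sorted by (auto simp: ns S_def S_verts_def)

lemma eccentricity_centre: "eccentricity (S ns) None = a"
proof (rule eccentricity_S_eqI[OF pos, of _ "Some (0, a - 1)"])
  show "S_dist (Some (i, j)) None \<le> a" if "i < length ns" "j < ns ! i" for i j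
    using that leg_le(1)[of i] by simp
qed (use leg_ends in \<open>auto simp: S_def S_verts_def\<close>)

text \<open>The tip of leg 0 is farthest: every other leg, including the vertex's own, has length at
  most \<open>a\<close>.\<close>

lemma eccentricity_short_leg:
  assumes "i < length ns" "i \<noteq> 0" "j < ns ! i"
  shows "eccentricity (S ns) (Some (i, j)) = a + Suc j"
proof (rule eccentricity_S_eqI[OF pos, of _ "Some (0, a - 1)"])
  show "S_dist (Some (i', j')) (Some (i, j)) \<le> a + Suc j"
    if "i' < length ns" "j' < ns ! i'" for i' j'
    using that leg_le(1)[of i'] by auto
qed (use leg_ends assms in \<open>auto simp: S_def S_verts_def\<close>)

lemma eccentricity_longest_leg:
  assumes "j < a"
  shows "eccentricity (S ns) (Some (0, j)) = max (b + Suc j) (a - Suc j)"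
proof (rule eccentricity_S_eqI[OF pos,
      \<comment> \<open>The farthest vertex is the tip of leg 1, reached through the centre, or the
        tip of leg 0 itself; the witness selects the larger distance.\<close>
      of _ "if a - Suc j \<le> b + Suc j then Some (1, b - 1) else Some (0, a - 1)"])
  show "S_dist (Some (i', j')) (Some (0, j)) \<le> max (b + Suc j) (a - Suc j)"
    if "i' < length ns" "j' < ns ! i'" for i' j'
    using that leg_le[of i'] by (auto simp: ns)
qed (use leg_ends assms in \<open>auto simp: S_def S_verts_def ns\<close>)

text \<open>Here \<open>t\<close> is the distance from the tip of leg 1 along the path formed by the
  first two legs, so the centre sits at \<open>t = b\<close>.\<close>

lemma sum_eccentricity_S:
  "(\<Sum>v \<in> pverts (S ns). eccentricity (S ns) v) =
     (\<Sum>t\<le>a + b. max t (a + b - t)) + (\<Sum>m\<leftarrow>r. \<Sum>j<m. a + Suc j)"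
proof -
  let ?e = "\<lambda>v. eccentricity (S ns) v"
  let ?f = "\<lambda>t. max t (a + b - t)"
  have "(\<Sum>v \<in> pverts (S ns). ?e v) =
      ?e None + (\<Sum>x \<in> (SIGMA i:{..<length ns}. {..<ns ! i}). ?e (Some x))"
    by (simp add: S_def S_verts_alt sum.reindex image_iff)
  also have "(\<Sum>x \<in> (SIGMA i:{..<length ns}. {..<ns ! i}). ?e (Some x)) =
      (\<Sum>i<length ns. \<Sum>j<ns ! i. ?e (Some (i, j)))"
    by (simp add: sum.Sigma)
  also have "\<dots> = (\<Sum>j<a. ?e (Some (0, j))) + (\<Sum>j<b. ?e (Some (1, j)))
      + (\<Sum>i<length r. \<Sum>j<r ! i. ?e (Some (Suc (Suc i), j)))"
    by (simp add: ns sum.lessThan_Suc_shift del: sum.lessThan_Suc)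
  also have "(\<Sum>j<a. ?e (Some (0, j))) = (\<Sum>j<a. ?f (b + Suc j))"
    by (intro sum.cong) (auto simp: eccentricity_longest_leg)
  also have "(\<Sum>j<b. ?e (Some (1, j))) = (\<Sum>j<b. a + Suc j)"
    using eccentricity_short_leg[of 1] by (intro sum.cong) (auto simp: ns)
  \<comment> \<open>Reversing leg 1 via \<open>t = b - Suc j\<close> turns \<open>a + Suc j\<close>
    into \<open>a + b - t\<close>, which is the maximum since \<open>b \<le> a\<close>.\<close>
  also have "(\<Sum>j<b. a + Suc j) = (\<Sum>t<b. ?f t)"
    using leg_ends(3) by (subst sum.nat_diff_reindex[symmetric]) (intro sum.cong; auto)
  also have "(\<Sum>i<length r. \<Sum>j<r ! i. ?e (Some (Suc (Suc i), j))) =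
      (\<Sum>i<length r. \<Sum>j<r ! i. a + Suc j)"
    using eccentricity_short_leg[of "Suc (Suc _)"] by (intro sum.cong) (auto simp: ns)
  also have "\<dots> = (\<Sum>m\<leftarrow>r. \<Sum>j<m. a + Suc j)"
    by (simp add: sum_list_sum_nth atLeast0LessThan)
  also have "?e None = ?f b"
    using leg_ends(3) by (simp add: eccentricity_centre)
  finally have "(\<Sum>v \<in> pverts (S ns). ?e v) =
      (\<Sum>t<b. ?f t) + (?f b + (\<Sum>j<a. ?f (b + Suc j))) + (\<Sum>m\<leftarrow>r. \<Sum>j<m. a + Suc j)"
    by simp
  also have "?f b + (\<Sum>j<a. ?f (b + Suc j)) = (\<Sum>j<Suc a. ?f (b + j))"
    by (simp add: sum.lessThan_Suc_shift del: sum.lessThan_Suc)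
  also have "(\<Sum>t<b. ?f t) + (\<Sum>j<Suc a. ?f (b + j)) = (\<Sum>t<b + Suc a. ?f t)"
    by (rule sum_lessThan_add[symmetric])
  also have "\<dots> = (\<Sum>t\<le>a + b. ?f t)"
    by (simp add: lessThan_Suc_atMost add.commute)
  finally show ?thesis .
qed

end

section \<open>Comparison under majorization\<close>

text \<open>Lengthening the path by one vertex decreases no old term and adds an end vertex whose
  term is at least \<open>D\<close>.\<close>

lemma path_eccentricity_growth:
  fixes D d :: nat
  shows "(\<Sum>t\<le>D. max t (D - t)) + D * d \<le> (\<Sum>t\<le>D + d. max t (D + d - t))"
proof (induction d)
  case (Suc d)
  have "(\<Sum>t\<le>D + d. max t (D + d - t)) \<le> (\<Sum>t\<le>D + d. max t (D + Suc d - t))"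
    by (intro sum_mono) auto
  then show ?case using Suc by simp
qed simp

text \<open>Right side minus left side is \<open>(y - x) * (y - x - 1) / 2\<close>, half a product
  of consecutive integers. Working in \<open>int\<close> allows \<open>y < x\<close>.\<close>

lemma sum_Suc_convex:
  fixes x y :: nat
  shows "int (\<Sum>j<y. Suc j) - int (\<Sum>j<x. Suc j) \<le> int y * (int y - int x)"
proof -
  have gauss: "2 * int (\<Sum>j<m. Suc j) = int m * (int m + 1)" for m
    by (induction m) (auto simp: algebra_simps)
  have "0 \<le> (int y - int x) * (int y - int x - 1)"
    by (cases "x < y") (auto intro: mult_nonneg_nonneg mult_nonpos_nonpos)
  then show ?thesis using gauss[of x] gauss[of y] by (simp add: algebra_simps)
qed

text \<open>Abel summation as an induction: the tail is bounded with slope \<open>y\<close>, the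
  head of the second list, and convexity gives the head the same slope. Suffix sums are used because
  they pass to tails unchanged.\<close>

lemma sum_list_triangular_le:
  fixes x y :: "nat list"
  assumes "length x = length y" "sorted_wrt (\<ge>) y" "\<forall>m \<in> set y. m \<le> h"
    and "\<And>j. sum_list (drop j x) \<le> sum_list (drop j y)"
  shows "int (\<Sum>m\<leftarrow>y. \<Sum>j<m. Suc j) - int (\<Sum>m\<leftarrow>x. \<Sum>j<m. Suc j)
    \<le> int h * (int (sum_list y) - int (sum_list x))"
  using assms
proof (induction x y arbitrary: h rule: list_induct2)
  case (Cons x xs y ys)
  have "sum_list (drop j xs) \<le> sum_list (drop j ys)" for j
    using Cons.prems(3)[of "Suc j"] by simp
  then have "int (\<Sum>m\<leftarrow>ys. \<Sum>j<m. Suc j) - int (\<Sum>m\<leftarrow>xs. \<Sum>j<m. Suc j)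
      \<le> int y * (int (sum_list ys) - int (sum_list xs))"
    using Cons.prems by (intro Cons.IH) auto
  then have "int (\<Sum>m\<leftarrow>y # ys. \<Sum>j<m. Suc j) - int (\<Sum>m\<leftarrow>x # xs. \<Sum>j<m. Suc j)
      \<le> int y * (int (sum_list (y # ys)) - int (sum_list (x # xs)))"
    using sum_Suc_convex[of y x] by (simp add: algebra_simps)
  \<comment> \<open>Raising the slope from \<open>y\<close> to \<open>h\<close> is sound because the
    difference of the full sums is nonnegative.\<close>
  also have "\<dots> \<le> int h * (int (sum_list (y # ys)) - int (sum_list (x # xs)))"
    using Cons.prems(2) Cons.prems(3)[of 0] by (intro mult_right_mono) auto
  finally show ?case .
qed simp

text \<open>With equal totals, larger prefix sums mean smaller suffix sums.\<close>

lemma majorizes_drop_le: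
  fixes x y :: "nat list"
  assumes "x \<succ> y"
  shows "sum_list (drop j x) \<le> sum_list (drop j y)"
proof (cases "1 \<le> j \<and> j < length x")
  case True
  then have maj: "sum_list (take j y) \<le> sum_list (take j x)" "sum_list x = sum_list y"
    using assms by (auto simp: majorizes_def)
  have split: "sum_list z = sum_list (take j z) + sum_list (drop j z)" for z :: "nat list"
    by (metis append_take_drop_id sum_list_append)
  show ?thesis using maj split[of x] split[of y] by linarith
next
  case False
  then show ?thesis using assms by (cases "j = 0") (auto simp: majorizes_def)
qed

lemma sum_list_affine_leg:
  "(\<Sum>m\<leftarrow>r. \<Sum>j<m. a + Suc j) = a * sum_list r + (\<Sum>m\<leftarrow>r. \<Sum>j<m. Suc j)"
  by (induction r)
    (simp_all only: list.map sum_list.Nil sum_list.Cons sum.distrib, simp_all add: algebra_simps)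

lemma majorizes_total_le:
  fixes a b a' b' :: nat and r r' :: "nat list"
  assumes maj: "(a # b # r) \<succ> (a' # b' # r')"
  shows "(\<Sum>t\<le>a' + b'. max t (a' + b' - t)) + (\<Sum>m\<leftarrow>r'. \<Sum>j<m. a' + Suc j)
    \<le> (\<Sum>t\<le>a + b. max t (a + b - t)) + (\<Sum>m\<leftarrow>r. \<Sum>j<m. a + Suc j)"
proof -
  let ?P = "\<lambda>D::nat. \<Sum>t\<le>D. max t (D - t)"
  let ?T = "\<lambda>r. \<Sum>m\<leftarrow>r. \<Sum>j<m. Suc j"
  have drop: "sum_list (drop j r) \<le> sum_list (drop j r')" for j
    using majorizes_drop_le[OF maj, of "Suc (Suc j)"] by simp
  have total: "a + b + sum_list r = a' + b' + sum_list r'"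
    using maj by (simp add: majorizes_def)
  have "a' \<le> a"
    using majorizes_drop_le[OF maj, of 1] total by simp
  \<comment> \<open>The amount moved from the remaining legs to the first two; the case
    \<open>j = 0\<close> of \<open>drop\<close> ensures that nothing is truncated.\<close>
  define d where "d = sum_list r' - sum_list r"
  have d: "sum_list r' = sum_list r + d" "a + b = a' + b' + d"
    using drop[of 0] total by (auto simp: d_def)
  have T: "?T r' \<le> ?T r + b' * d"
  proof -
    \<comment> \<open>Sortedness bounds all entries of \<open>r'\<close> by \<open>b'\<close>, which
      serves as the slope.\<close>
    have "int (?T r') - int (?T r) \<le> int b' * (int (sum_list r') - int (sum_list r))"
      using maj by (intro sum_list_triangular_le drop) (auto simp: majorizes_def)
    then have "int (?T r') \<le> int (?T r + b' * d)" by (simp add: d)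
    then show ?thesis by (simp only: of_nat_le_iff)
  qed
  have "?P (a' + b') + (a' + b') * d \<le> ?P (a + b)"
    using path_eccentricity_growth[of "a' + b'" d] by (simp only: d(2))
  moreover have "a' * sum_list r \<le> a * sum_list r"
    using \<open>a' \<le> a\<close> by (rule mult_le_mono1)
  \<comment> \<open>The path gain \<open>(a' + b') * d\<close> pays for both losses:
    \<open>a' * d\<close> in the linear term and \<open>b' * d\<close> in the triangular
    one.\<close>
  ultimately show ?thesis
    using T unfolding sum_list_affine_leg d(1) distrib_left distrib_right by linarith
qed

theorem mainTheorem4:
  fixes k n :: nat and p q :: "nat list"
  assumes "k \<ge> 2"
    and "length p = k" and "length q = k"
    and "\<forall>m \<in> set p. m > 0" and "\<forall>m \<in> set q. m > 0"
    and "p \<succ> q"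
    and "sum_list p = n - 1" and "sum_list q = n - 1"
  shows "ecc (S p) \<ge> ecc (S q)"
proof -
  obtain a b r where p: "p = a # b # r"
    using assms(1,2) by (metis One_nat_def Suc_1 Suc_le_length_iff)
  obtain a' b' r' where q: "q = a' # b' # r'"
    using assms(1,3) by (metis One_nat_def Suc_1 Suc_le_length_iff)
  have "sorted_wrt (\<ge>) p" "sorted_wrt (\<ge>) q"
    using assms(6) by (auto simp: majorizes_def)
  then have "(\<Sum>v \<in> pverts (S q). eccentricity (S q) v) \<le> (\<Sum>v \<in> pverts (S p). eccentricity (S p) v)"
    using majorizes_total_le assms(4-6) p q by (simp add: sum_eccentricity_S)
  then have "(\<Sum>v \<in> pverts (S q). real (eccentricity (S q) v))
      \<le> (\<Sum>v \<in> pverts (S p). real (eccentricity (S p) v))"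
    unfolding of_nat_sum[symmetric] of_nat_le_iff .
  moreover have "card (pverts (S p)) = card (pverts (S q))"
    using assms(7,8) by (simp add: card_S_verts)
  ultimately show ?thesis
    by (simp add: ecc_def divide_right_mono)
qed

end
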